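(* Let $\mathcal{H}$ be a Hilbert space and let $f,g:\mathcal{H}\to\mathbb{R}$ be two convex functions of class $\mathcal{C}^{1,1}_{\rm loc}$ such that (i) $\|\nabla f(x)\|=\|\nabla g(x)\|$ for all $x\in\mathcal{H}$; and (ii) $p_f=p_g$. Then $f$ and $g$ are equal up to an additive constant, i.e. there exists $c\in\mathbb{R}$ with $f=g+c$ on $\mathcal{H}$.
   Context: $\mathcal{H}$ is a real Hilbert space with norm $\|\cdot\|$, not assumed separable. A function is of class $\mathcal{C}^{1,1}_{\rm loc}$ if it is (Fréchet) continuously differentiable and its gradient is locally Lipschitz. For a lower semicontinuous convex function $f$ with convex subdifferential $\partial f$, write $\partial f(\mathcal{H})=\bigcup_{x\in\mathcal{H}}\partial f(x)$; its closure $\overline{\partial f(\mathcal{H})}$ is convex. The Crandall-Pazy direction of $f$ is $p_f:=\mathrm{proj}_{\overline{\partial f(\mathcal{H})}}(0)$, the unique element of minimal norm of $\overline{\partial f(\mathcal{H})}$. For differentiable $f$, $\partial f(\mathcal{H})=\nabla f(\mathcal{H})$. Functions are not assumed bounded from below. *)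

theory Defs
  imports "HOL-Analysis.Analysis"
begin

text \<open>
  Real Hilbert spaces are types of sort \<open>{real_inner, complete_space}\<close>;
  no separability or finiteness of the dimension is implied.
\<close>

text \<open>
  For \<open>f\<close> Frechet differentiable at \<open>x\<close>, the vector below exists by Riesz representation
  and is unique; otherwise the value is unspecified.
\<close>
definition gradient :: "('a::real_inner \<Rightarrow> real) \<Rightarrow> 'a \<Rightarrow> 'a" where
  "gradient f x = (THE D. GDERIV f x :> D)"

lemma gradient_eqI:
  assumes "GDERIV f x :> D"
  shows "gradient f x = D"
  unfolding gradient_def
proof (rule the_equality)
  fix E assume "GDERIV f x :> E"
  with assms have "(\<lambda>h. inner h E) = (\<lambda>h. inner h D)"
    unfolding gderiv_def by (metis has_derivative_unique)
  then have "inner (E - D) E = inner (E - D) D" by metis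
  then have "inner (E - D) (E - D) = 0" by (simp add: inner_diff_right)
  then show "E = D" by simp
qed (fact assms)

definition C11_loc :: "('a::real_inner \<Rightarrow> real) \<Rightarrow> bool" where
  "C11_loc f \<longleftrightarrow>
     (\<forall>x. f differentiable (at x)) \<and>
     continuous_on UNIV (gradient f) \<and>
     (\<forall>x. \<exists>r>0. \<exists>L. lipschitz_on L (ball x r) (gradient f))"

definition subdifferential :: "('a::real_inner \<Rightarrow> real) \<Rightarrow> 'a \<Rightarrow> 'a set" where
  "subdifferential f x = {v. \<forall>y. f y \<ge> f x + inner v (y - x)}"

text \<open>
  The library's \<open>closest_point\<close> is restricted to the class \<open>heine_borel\<close>, hence to finite
  dimension. The point below exists and is unique if \<open>C\<close> is nonempty, closed and convex in a
  Hilbert space.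
\<close>
definition metric_proj :: "'a::metric_space set \<Rightarrow> 'a \<Rightarrow> 'a" where
  "metric_proj C x = (THE p. p \<in> C \<and> (\<forall>q\<in>C. dist x p \<le> dist x q))"

definition crandall_pazy :: "('a::real_inner \<Rightarrow> real) \<Rightarrow> 'a" where
  "crandall_pazy f = metric_proj (closure (\<Union>x. subdifferential f x)) 0"

end

theory Submission
  imports Defs
begin

text \<open>
  Put \<open>h = f - g\<close>, \<open>s = f + g\<close> and \<open>N x = \<parallel>\<nabla>f x\<parallel> = \<parallel>\<nabla>g x\<parallel>\<close>. Equality of the norms
  says that \<open>\<nabla>h\<close> and \<open>\<nabla>s\<close> are orthogonal, so \<open>h\<close> is constant along the steepest descent
  curves \<open>x' = -\<nabla>s(x)\<close>. Two such curves never move apart, because \<open>s\<close> is convex. Moreover \<open>N\<close>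
  does not increase along them: a descent step for \<open>f\<close> shrinks \<open>\<parallel>\<nabla>f\<parallel>\<close> and a descent step for
  \<open>g\<close> shrinks \<open>\<parallel>\<nabla>g\<parallel>\<close>, and both norms are \<open>N\<close>.

  Let \<open>x\<close>, \<open>z\<close>, \<open>w\<close> be three such curves. Since
  \<open>d/dt \<parallel>x - w\<parallel>\<^sup>2 = -2 \<langle>\<nabla>s(x) - \<nabla>s(w), x - w\<rangle>\<close>, the monotonicity gaps of the pairs
  \<open>(x, w)\<close> and \<open>(z, w)\<close> are integrable over all time, so at some time both are tiny. A gap of \<open>s\<close>
  bounds the error of linearizing \<open>f\<close> and \<open>g\<close>, hence also \<open>h\<close>, at \<open>w\<close> (lemma
  \<open>linearization_error_le_gap\<close>). At that time \<open>h(x) - h(z)\<close> is therefore almost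
  \<open>\<langle>\<nabla>h(w), x - z\<rangle>\<close>, while \<open>h(x)\<close> and \<open>h(z)\<close> still have their initial values and \<open>\<parallel>x - z\<parallel>\<close>
  is at most its initial value. So \<open>h\<close> is constant as soon as \<open>\<nabla>h(w)\<close> can be kept small.

  This is where the common Crandall-Pazy direction \<open>p\<close> enters. The curve \<open>w\<close> is started at a point
  where \<open>N\<close> is close to \<open>\<parallel>p\<parallel>\<close>, and \<open>N(w)\<close> stays that small. As \<open>p\<close> is the shortest element of the
  midpoint-convex sets \<open>closure (range \<nabla>f)\<close> and \<open>closure (range \<nabla>g)\<close>, the parallelogram law
  forces all short gradients of \<open>f\<close> and of \<open>g\<close> to be near \<open>p\<close> (lemma
  \<open>crandall_pazy_near_short_gradients\<close>), hence near each other.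

  No differential equation has to be solved: only finitely many quantities are monitored, up to an
  arbitrarily small error and for a bounded time, so explicit Euler steps suffice. Their lengths
  cannot be bounded below in advance, and \<open>drop_principle\<close> replaces the choice of step lengths by a
  completeness argument. The same principle shows that a differentiable function bounded below has
  almost critical points, which gives the midpoint-convexity of the closed range of a gradient.
\<close>

section \<open>A completeness principle for short steps\<close>

text \<open>
  An Ekeland-type principle in contrapositive form: a process that advances in time and moves at
  speed at most \<open>M\<close> cannot be prolongable from every state of a closed set if time is bounded.
  Greedy steps, each covering at least half of the time still reachable, form a Cauchy sequence, and
  a prolongation of their limit would have been reachable from every earlier state.
\<close>
lemma drop_principle:
  fixes G :: "(real \<times> 'b::complete_space) set"
  assumes G: "closed G" and start: "(t0, x0) \<in> G"
    and bound: "\<And>t x. (t, x) \<in> G \<Longrightarrow> t \<le> T"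
    and step: "\<And>t x. (t, x) \<in> G \<Longrightarrow> \<exists>t' x'. (t', x') \<in> G \<and> t < t' \<and> dist x x' \<le> M * (t' - t)"
  shows False
proof -
  define reach where "reach p q \<longleftrightarrow> q \<in> G \<and> fst p \<le> fst q \<and> dist (snd p) (snd q) \<le> M * (fst q - fst p)"
    for p q :: "real \<times> 'b"
  have reach_trans: "reach p r" if "reach p q" "reach q r" for p q r
    using that dist_triangle[of "snd p" "snd r" "snd q"] by (auto simp: reach_def algebra_simps)
  define far where "far p = (SUP q\<in>{q. reach p q}. fst q)" for p
  have bdd: "bdd_above (fst ` {q. reach p q})" for p
    using bound by (force simp: reach_def bdd_above_def)
  have le_far: "fst q \<le> far p" if "reach p q" for p q
    unfolding far_def using that bdd by (intro cSUP_upper) auto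
  have reach_self: "reach p p" if "p \<in> G" for p
    using that by (auto simp: reach_def)
  have halfway: "\<exists>q. q \<in> G \<and> reach p q \<and> (fst p + far p) / 2 \<le> fst q" if "p \<in> G" for p
  proof (cases "far p = fst p")
    case True
    with that reach_self show ?thesis by (intro exI[of _ p]) auto
  next
    case False
    with le_far[OF reach_self[OF that]] have "(fst p + far p) / 2 < (SUP q\<in>{q. reach p q}. fst q)"
      by (simp add: far_def)
    moreover have "{q. reach p q} \<noteq> {}" using reach_self[OF that] by blast
    ultimately obtain q where "reach p q" "(fst p + far p) / 2 < fst q"
      using less_cSUP_iff[OF _ bdd] by blast
    then show ?thesis by (intro exI[of _ q]) (simp add: reach_def)
  qed
  obtain P where P: "\<And>n. P n \<in> G" "\<And>n. reach (P n) (P (Suc n))"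
      "\<And>n. (fst (P n) + far (P n)) / 2 \<le> fst (P (Suc n))"
    using dependent_nat_choice[where P = "\<lambda>_ p. p \<in> G"
        and Q = "\<lambda>_ p q. reach p q \<and> (fst p + far p) / 2 \<le> fst q"] start halfway
    by (metis (no_types, lifting))
  have chain: "reach (P m) (P n)" if "m \<le> n" for m n
    using that by (induction rule: dec_induct) (auto intro: reach_self P reach_trans)
  have inc: "incseq (\<lambda>n. fst (P n))"
    using chain by (auto simp: incseq_def reach_def)
  moreover have "fst (P n) \<le> T" for n
    using bound[of "fst (P n)" "snd (P n)"] P(1) by simp
  ultimately obtain t where t: "(\<lambda>n. fst (P n)) \<longlonglongrightarrow> t" "\<And>n. fst (P n) \<le> t"
    by (metis incseq_convergent)
  have M: "0 \<le> M"
  proof -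
    obtain t' x' where "t0 < t'" "dist x0 x' \<le> M * (t' - t0)"
      using step[OF start] by blast
    then show ?thesis
      by (smt (verit) mult_neg_pos zero_le_dist)
  qed
  have "Cauchy (\<lambda>n. snd (P n))"
  proof (rule metric_CauchyI)
    fix e :: real assume "e > 0"
    then have "e / (M + 1) > 0" using M by simp
    then obtain N where N: "\<And>n. n \<ge> N \<Longrightarrow> t - fst (P n) < e / (M + 1)"
      using t(1) unfolding lim_sequentially dist_real_def by (metis abs_le_D2 abs_minus_commute le_less_trans order_refl abs_less_iff)
    have *: "dist (snd (P m)) (snd (P n)) < e" if "N \<le> m" "m \<le> n" for m n
    proof -
      have "dist (snd (P m)) (snd (P n)) \<le> M * (fst (P n) - fst (P m))"
        using chain[OF that(2)] by (simp add: reach_def)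
      also have "\<dots> \<le> M * (t - fst (P m))"
        using M t(2)[of n] by (intro mult_left_mono) auto
      also have "\<dots> \<le> (M + 1) * (t - fst (P m))"
        using t(2)[of m] by (intro mult_right_mono) auto
      also have "\<dots> < e" 
        using N[OF that(1)] M by (simp add: field_simps)
      finally show ?thesis .
    qed
    show "\<exists>N. \<forall>m\<ge>N. \<forall>n\<ge>N. dist (snd (P m)) (snd (P n)) < e"
      using * by (metis dist_commute nle_le)
  qed
  then obtain x where x: "(\<lambda>n. snd (P n)) \<longlonglongrightarrow> x"
    using Cauchy_convergent convergent_def by blast
  have lim: "P \<longlonglongrightarrow> (t, x)"
    using tendsto_Pair[OF t(1) x] by simp
  with G P(1) have "(t, x) \<in> G"
    using closed_sequentially by blast
  from step[OF this] obtain t' x' where t': "(t', x') \<in> G" "t < t'" "dist x x' \<le> M * (t' - t)"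
    by blast
  have reach_limit: "reach (P n) (t, x)" for n
  proof -
    have "dist (snd (P n)) x \<le> M * (t - fst (P n))"
    proof (rule tendsto_le[OF sequentially_bot])
      show "(\<lambda>k. dist (snd (P n)) (snd (P k))) \<longlonglongrightarrow> dist (snd (P n)) x"
        by (intro tendsto_intros x)
      show "(\<lambda>k. M * (fst (P k) - fst (P n))) \<longlonglongrightarrow> M * (t - fst (P n))"
        by (intro tendsto_intros t)
      show "\<forall>\<^sub>F k in sequentially. dist (snd (P n)) (snd (P k)) \<le> M * (fst (P k) - fst (P n))"
        using chain by (auto simp: eventually_sequentially reach_def)
    qed
    with \<open>(t, x) \<in> G\<close> t(2) show ?thesis by (simp add: reach_def)
  qed
  have "(fst (P n) + t') / 2 \<le> fst (P (Suc n))" for n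
  proof -
    have "reach (t, x) (t', x')" using t' by (simp add: reach_def)
    then have "t' \<le> far (P n)"
      using le_far[OF reach_trans[OF reach_limit]] by force
    with P(3)[of n] show ?thesis by (simp add: field_simps)
  qed
  then have "(t + t') / 2 \<le> t"
    using t(1) by (intro LIMSEQ_le[OF tendsto_divide[OF tendsto_add[OF t(1) tendsto_const] tendsto_const] LIMSEQ_Suc[OF t(1)]]) auto
  with t'(2) show False by simp
qed

section \<open>Shortest elements and gradients in Hilbert space\<close>

lemma parallelogram_midpoint:
  fixes p q :: "'a::real_inner"
  shows "(norm (p - q))\<^sup>2 = 2 * (norm p)\<^sup>2 + 2 * (norm q)\<^sup>2 - 4 * (norm (midpoint p q))\<^sup>2"
  by (simp add: midpoint_def power2_norm_eq_inner inner_simps inner_commute algebra_simps)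

text \<open>
  By the parallelogram law, minimizing sequences for the norm are Cauchy; only midpoints of elements
  of \<open>C\<close> occur in this argument.
\<close>
lemma ex_minimal_norm:
  fixes C :: "'a::{real_inner, complete_space} set"
  assumes C: "closed C" "C \<noteq> {}" and mid: "\<And>a b. a \<in> C \<Longrightarrow> b \<in> C \<Longrightarrow> midpoint a b \<in> C"
  obtains p where "p \<in> C" "\<And>q. q \<in> C \<Longrightarrow> norm p \<le> norm q"
proof -
  define d where "d = (INF q\<in>C. norm q)"
  have bdd: "bdd_below (norm ` C)" by (auto intro: bdd_belowI[of _ 0])
  have d_le: "d \<le> norm q" if "q \<in> C" for q
    unfolding d_def using that bdd by (intro cINF_lower) auto
  have d0: "0 \<le> d" unfolding d_def using C(2) by (intro cINF_greatest) auto
  have "\<exists>q\<in>C. norm q < d + inverse (Suc n)" for n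
    using cINF_less_iff[OF C(2) bdd, of "d + inverse (Suc n)"] by (simp add: d_def)
  then obtain q where q: "\<And>n. q n \<in> C" "\<And>n. norm (q n) < d + inverse (Suc n)" by metis
  have "(\<lambda>n. norm (q n)) \<longlonglongrightarrow> d"
  proof (rule tendsto_sandwich[where f = "\<lambda>_. d" and h = "\<lambda>n. d + inverse (Suc n)"])
    show "(\<lambda>n. d + inverse (Suc n)) \<longlonglongrightarrow> d"
      using tendsto_add[OF tendsto_const LIMSEQ_inverse_real_of_nat, of d] by simp
  qed (use q d_le in \<open>auto intro!: always_eventually less_imp_le\<close>)
  then have lim2: "(\<lambda>n. (norm (q n))\<^sup>2) \<longlonglongrightarrow> d\<^sup>2" by (rule tendsto_power)
  have close: "(norm (q m - q n))\<^sup>2 \<le> 2 * ((norm (q m))\<^sup>2 - d\<^sup>2) + 2 * ((norm (q n))\<^sup>2 - d\<^sup>2)" for m n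
  proof -
    have "d\<^sup>2 \<le> (norm (midpoint (q m) (q n)))\<^sup>2"
      using d_le[OF mid[OF q(1) q(1)]] d0 by (rule power_mono)
    then show ?thesis by (simp add: parallelogram_midpoint)
  qed
  have "Cauchy q"
  proof (rule CauchyI)
    fix e :: real assume "e > 0"
    then have "e\<^sup>2 / 4 > 0" by simp
    then obtain N where N: "\<And>n. n \<ge> N \<Longrightarrow> (norm (q n))\<^sup>2 - d\<^sup>2 < e\<^sup>2 / 4"
      using lim2 unfolding lim_sequentially dist_real_def by (metis abs_less_iff)
    have "norm (q m - q n) < e" if "m \<ge> N" "n \<ge> N" for m n
    proof (rule power2_less_imp_less)
      show "(norm (q m - q n))\<^sup>2 < e\<^sup>2"
        using close[of m n] N[OF that(1)] N[OF that(2)] by simp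
    qed (use \<open>e > 0\<close> in simp)
    then show "\<exists>N. \<forall>m\<ge>N. \<forall>n\<ge>N. norm (q m - q n) < e" by blast
  qed
  then obtain p where p: "q \<longlonglongrightarrow> p"
    using Cauchy_convergent convergent_def by blast
  have "p \<in> C" using closed_sequentially[OF C(1) _ p] q by blast
  moreover have "norm p = d"
    using LIMSEQ_unique[OF tendsto_norm[OF p] \<open>(\<lambda>n. norm (q n)) \<longlonglongrightarrow> d\<close>] .
  ultimately show thesis using that d_le by metis
qed

text \<open>
  The representing vector is a multiple of the shortest point of the hyperplane \<open>\<phi> = 1\<close>, which is
  orthogonal to the kernel of \<open>\<phi>\<close>. The result ensures that the description operator in
  \<open>gradient\<close> denotes an actual gradient.
\<close>
lemma riesz_representation:
  fixes \<phi> :: "'a::{real_inner, complete_space} \<Rightarrow> real"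
  assumes "bounded_linear \<phi>"
  obtains D where "\<And>h. \<phi> h = inner h D"
proof (cases "\<forall>h. \<phi> h = 0")
  case True
  then show thesis using that[of 0] by simp
next
  case False
  interpret bounded_linear \<phi> by fact
  from False obtain u where u: "\<phi> u \<noteq> 0" by blast
  define C where "C = {x. \<phi> x = 1}"
  have "closed C" unfolding C_def
    by (intro closed_Collect_eq continuous_intros linear_continuous_on assms)
  moreover have "u /\<^sub>R \<phi> u \<in> C" using u by (simp add: C_def scaleR)
  moreover have "midpoint a b \<in> C" if "a \<in> C" "b \<in> C" for a b
    using that by (simp add: C_def midpoint_def scaleR add)
  ultimately obtain p where p: "p \<in> C" "\<And>q. q \<in> C \<Longrightarrow> norm p \<le> norm q"
    using ex_minimal_norm[of C] by blast
  have ker: "inner v p = 0" if "\<phi> v = 0" for v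
  proof (rule ccontr)
    assume ne: "inner v p \<noteq> 0"
    then have v: "v \<noteq> 0" by auto
    \<comment> \<open>The multiple of \<open>v\<close> that brings \<open>p\<close> closest to the origin.\<close>
    define t where "t = - inner v p / (norm v)\<^sup>2"
    have "p + t *\<^sub>R v \<in> C" using p(1) that by (simp add: C_def add scaleR)
    then have "(norm p)\<^sup>2 \<le> (norm (p + t *\<^sub>R v))\<^sup>2" using p(2) by (intro power_mono) auto
    also have "\<dots> = (norm p)\<^sup>2 + 2 * t * inner v p + t\<^sup>2 * (norm v)\<^sup>2"
      unfolding power2_norm_eq_inner
      by (simp add: inner_simps inner_commute power2_eq_square algebra_simps)
    also have "\<dots> = (norm p)\<^sup>2 - (inner v p)\<^sup>2 / (norm v)\<^sup>2"
      using v by (simp add: t_def power2_eq_square field_simps)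
    finally show False using ne v by (simp add: divide_le_0_iff)
  qed
  have "p \<noteq> 0" using p(1) zero by (auto simp: C_def)
  have "\<phi> h = inner h (p /\<^sub>R (norm p)\<^sup>2)" for h
  proof -
    have "inner (h - \<phi> h *\<^sub>R p) p = 0"
      using p(1) by (intro ker) (simp add: C_def diff scaleR)
    then show ?thesis using \<open>p \<noteq> 0\<close>
      by (simp add: inner_simps power2_norm_eq_inner)
  qed
  then show thesis by (rule that)
qed

lemma GDERIV_gradient:
  fixes f :: "'a::{real_inner, complete_space} \<Rightarrow> real"
  assumes "f differentiable (at x)"
  shows "GDERIV f x :> gradient f x"
proof -
  obtain f' where f': "(f has_derivative f') (at x)"
    using assms by (auto simp: differentiable_def)
  obtain D where "\<And>h. f' h = inner h D"
    using riesz_representation[OF has_derivative_bounded_linear[OF f']] by blast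
  then have "f' = (\<lambda>h. inner h D)" by blast
  with f' have "GDERIV f x :> D" by (simp add: gderiv_def)
  then show ?thesis using gradient_eqI by metis
qed

lemma GDERIV_directional:
  assumes "GDERIV f x :> D"
  shows "((\<lambda>t. f (x + t *\<^sub>R v)) has_real_derivative inner v D) (at 0)"
proof -
  have "(f has_derivative (\<lambda>h. inner h D)) (at (x + 0 *\<^sub>R v))"
    using assms by (simp add: gderiv_def)
  moreover have "((\<lambda>t. x + t *\<^sub>R v) has_derivative (\<lambda>t. t *\<^sub>R v)) (at 0)"
    by (auto intro!: derivative_eq_intros)
  ultimately have "((\<lambda>t. f (x + t *\<^sub>R v)) has_derivative (\<lambda>t. inner (t *\<^sub>R v) D)) (at 0)"
    by (rule has_derivative_compose[rotated])
  then show ?thesis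
    by (simp add: has_field_derivative_def mult_commute_abs)
qed

lemma GDERIV_step:
  assumes "GDERIV f x :> D" and "\<eta> > 0"
  shows "\<forall>\<^sub>F \<tau> in at_right 0. \<bar>f (x + \<tau> *\<^sub>R v) - f x - \<tau> * inner v D\<bar> \<le> \<eta> * \<tau>"
proof -
  have "((\<lambda>t. (f (x + t *\<^sub>R v) - f x) / t) \<longlongrightarrow> inner v D) (at_right 0)"
    using GDERIV_directional[OF assms(1), of v]
    by (auto simp: has_field_derivative_iff intro: tendsto_mono[OF at_le])
  from tendstoD[OF this assms(2)] eventually_at_right_less[of "0::real"]
  show ?thesis
  proof eventually_elim
    case (elim \<tau>)
    then have "f (x + \<tau> *\<^sub>R v) - f x - \<tau> * inner v D = \<tau> * ((f (x + \<tau> *\<^sub>R v) - f x) / \<tau> - inner v D)"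
      by (simp add: field_simps)
    with elim show ?case by (simp add: abs_mult dist_real_def mult.commute)
  qed
qed

section \<open>Gradients of convex functions\<close>

lemma convex_gradient_inequality:
  fixes f :: "'a::real_inner \<Rightarrow> real"
  assumes "convex_on UNIV f" and "GDERIV f x :> D"
  shows "f x + inner D (y - x) \<le> f y"
proof -
  have "((\<lambda>t. (f (x + t *\<^sub>R (y - x)) - f x) / t) \<longlongrightarrow> inner (y - x) D) (at_right 0)"
    using GDERIV_directional[OF assms(2), of "y - x"]
    by (auto simp: has_field_derivative_iff intro: tendsto_mono[OF at_le])
  moreover have "\<forall>\<^sub>F t in at_right 0. (f (x + t *\<^sub>R (y - x)) - f x) / t \<le> f y - f x"
  proof -
    have "\<forall>\<^sub>F t in at_right 0. (0::real) < t \<and> t < 1"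
      using eventually_at_right_real[of 0 "1::real"] by simp
    then show ?thesis
    proof eventually_elim
      case (elim t)
      have "f ((1 - t) *\<^sub>R x + t *\<^sub>R y) \<le> (1 - t) * f x + t * f y"
        using elim assms(1) by (intro convex_onD) auto
      then have "f (x + t *\<^sub>R (y - x)) - f x \<le> t * (f y - f x)"
        by (simp add: algebra_simps)
      with elim show ?case by (simp add: field_simps)
    qed
  qed
  ultimately have "inner (y - x) D \<le> f y - f x"
    by (intro tendsto_upperbound) auto
  then show ?thesis by (simp add: inner_commute)
qed

text \<open>
  If \<open>v\<close> is a subgradient, comparing the subgradient inequality with the derivative in the direction
  \<open>v - D\<close> gives \<open>\<parallel>v - D\<parallel>\<^sup>2 \<le> 0\<close>.
\<close>
lemma subdifferential_eq_gradient:
  fixes f :: "'a::real_inner \<Rightarrow> real"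
  assumes "convex_on UNIV f" and D: "GDERIV f x :> D"
  shows "subdifferential f x = {D}"
proof (intro equalityI subsetI)
  fix v assume v: "v \<in> subdifferential f x"
  have "\<forall>\<^sub>F t in at_right (0::real). (norm (v - D))\<^sup>2 \<le> e" if "e > 0" for e
    using GDERIV_step[OF D that, of "v - D"] eventually_at_right_less[of "0::real"]
  proof eventually_elim
    case (elim t)
    have "f x + t * inner v (v - D) \<le> f (x + t *\<^sub>R (v - D))"
      using v unfolding subdifferential_def by (smt (verit) add_diff_cancel_left' inner_scaleR_right mem_Collect_eq)
    with elim have "t * inner (v - D) (v - D) \<le> t * e"
      by (simp add: inner_simps inner_commute algebra_simps)
    with elim show ?case by (simp add: power2_norm_eq_inner)
  qed
  then have "(norm (v - D))\<^sup>2 \<le> e" if "e > 0" for e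
    using that by (simp add: eventually_const)
  then have "(norm (v - D))\<^sup>2 \<le> 0" by (rule field_le_epsilon) simp
  then show "v \<in> {D}" by simp
qed (use convex_gradient_inequality[OF assms] in \<open>auto simp: subdifferential_def\<close>)

text \<open>
  Otherwise \<open>\<phi>\<close> could be decreased at rate \<open>\<epsilon> / 2\<close> per unit of length from every point, and
  \<open>drop_principle\<close>, with arc length as time, would contradict the lower bound.
\<close>
lemma almost_critical_point:
  fixes \<phi> :: "'a::{real_inner, complete_space} \<Rightarrow> real"
  assumes D: "\<And>x. GDERIV \<phi> x :> D x" and below: "\<And>x. m \<le> \<phi> x" and "\<epsilon> > 0"
  shows "\<exists>x. norm (D x) \<le> \<epsilon>"
proof (rule ccontr)
  assume "\<not> ?thesis"
  then have big: "\<epsilon> < norm (D x)" for x by (simp add: not_le)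
  define G where "G = {X :: real \<times> 'a. \<phi> (snd X) \<le> \<phi> 0 - \<epsilon> / 2 * fst X}"
  have cont: "continuous_on UNIV \<phi>"
    using D unfolding gderiv_def by (meson has_derivative_continuous continuous_at_imp_continuous_on)
  show False
  proof (rule drop_principle)
    show "closed G" unfolding G_def
      by (intro closed_Collect_le continuous_intros continuous_on_compose2[OF cont]) auto
    show "(0, 0) \<in> G" by (simp add: G_def)
    show "t \<le> (\<phi> 0 - m) / (\<epsilon> / 2)" if "(t, x) \<in> G" for t x
      using that below[of x] \<open>\<epsilon> > 0\<close> by (simp add: G_def field_simps)
    show "\<exists>t' x'. (t', x') \<in> G \<and> t < t' \<and> dist x x' \<le> 1 * (t' - t)" if "(t, x) \<in> G" for t x
    proof -
      define u where "u = - sgn (D x)"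
      have "D x \<noteq> 0" using big[of x] \<open>\<epsilon> > 0\<close> by auto
      then have u: "inner u (D x) = - norm (D x)" "norm u = 1"
        by (simp_all add: u_def sgn_div_norm dot_square_norm power2_eq_square)
      have "\<forall>\<^sub>F \<tau> in at_right 0. (t + \<tau>, x + \<tau> *\<^sub>R u) \<in> G \<and> 0 < \<tau>"
        using GDERIV_step[OF D half_gt_zero[OF \<open>\<epsilon> > 0\<close>], of x u] eventually_at_right_less[of "0::real"]
      proof eventually_elim
        case (elim \<tau>)
        have "\<epsilon> * \<tau> \<le> \<tau> * norm (D x)" using elim big[of x] by (simp add: mult.commute)
        moreover have "\<phi> (x + \<tau> *\<^sub>R u) \<le> \<phi> x - \<tau> * norm (D x) + \<epsilon> / 2 * \<tau>"
          using abs_le_D1[OF elim(1)] u by simp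
        moreover have "\<phi> x \<le> \<phi> 0 - \<epsilon> / 2 * t" using that by (simp add: G_def)
        ultimately have "\<phi> (x + \<tau> *\<^sub>R u) \<le> \<phi> 0 - \<epsilon> / 2 * (t + \<tau>)"
          by (simp only: distrib_left)
        then show ?case using elim(2) by (simp add: G_def)
      qed
      then obtain \<tau> where "(t + \<tau>, x + \<tau> *\<^sub>R u) \<in> G" "0 < \<tau>"
        using eventually_happens' trivial_limit_at_right_real by blast
      then show ?thesis using u(2)
        by (intro exI[of _ "t + \<tau>"] exI[of _ "x + \<tau> *\<^sub>R u"]) (auto simp: dist_norm)
    qed
  qed
qed

text \<open>
  For the midpoint \<open>m\<close> of two gradients of \<open>f\<close>, the tilted function \<open>f - \<langle>m, _\<rangle>\<close> is bounded
  below by the average of two tangents of \<open>f\<close>, whose slopes cancel the tilt. Its almost critical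
  points have gradients of \<open>f\<close> arbitrarily close to \<open>m\<close>.
\<close>
lemma closure_range_gradient_midpoint:
  fixes f :: "'a::{real_inner, complete_space} \<Rightarrow> real"
  assumes conv: "convex_on UNIV f" and F: "\<And>x. GDERIV f x :> F x"
    and ab: "a \<in> closure (range F)" "b \<in> closure (range F)"
  shows "midpoint a b \<in> closure (range F)"
proof -
  have mid: "midpoint (F u) (F v) \<in> closure (range F)" for u v
  proof (unfold closure_approachable, intro allI impI)
    fix e :: real assume "e > 0"
    define m where "m = midpoint (F u) (F v)"
    have "GDERIV (\<lambda>x. f x - inner m x) x :> F x - m" for x
      using F[of x] unfolding gderiv_def
      by (auto intro!: derivative_eq_intros simp: inner_simps inner_commute)
    moreover have "(f u - inner (F u) u + f v - inner (F v) v) / 2 \<le> f x - inner m x" for x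
      using convex_gradient_inequality[OF conv F, of u x] convex_gradient_inequality[OF conv F, of v x]
      by (simp add: m_def midpoint_def inner_simps field_simps)
    ultimately obtain x where "norm (F x - m) \<le> e / 2"
      using almost_critical_point[where \<phi> = "\<lambda>x. f x - inner m x" and D = "\<lambda>x. F x - m" and \<epsilon> = "e / 2"]
        half_gt_zero[OF \<open>e > 0\<close>] by blast
    then show "\<exists>y\<in>range F. dist y (midpoint (F u) (F v)) < e"
      using \<open>e > 0\<close> by (auto simp: dist_norm m_def intro!: exI[of _ x])
  qed
  obtain p q where pq: "\<And>n. p n \<in> range F" "p \<longlonglongrightarrow> a" "\<And>n. q n \<in> range F" "q \<longlonglongrightarrow> b"
    using ab unfolding closure_sequential by blast
  have "(\<lambda>n. midpoint (p n) (q n)) \<longlonglongrightarrow> midpoint a b"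
    unfolding midpoint_def by (intro tendsto_intros pq)
  moreover have "midpoint (p n) (q n) \<in> closure (range F)" for n
    using pq(1)[of n] pq(3)[of n] mid by auto
  ultimately show ?thesis
    by (rule closed_sequentially[OF closed_closure, rotated])
qed

text \<open>
  The second claim is a quantitative uniqueness of the shortest element: the midpoint of \<open>q\<close> and the
  Crandall-Pazy direction is again in the closed range, hence not shorter than that direction, and
  the parallelogram law converts this into a bound for the distance.
\<close>
lemma crandall_pazy_near_short_gradients:
  fixes f :: "'a::{real_inner, complete_space} \<Rightarrow> real"
  assumes conv: "convex_on UNIV f" and F: "\<And>x. GDERIV f x :> F x"
  shows "crandall_pazy f \<in> closure (range F)"
    and "q \<in> closure (range F) \<Longrightarrow>
      (norm (q - crandall_pazy f))\<^sup>2 \<le> 2 * ((norm q)\<^sup>2 - (norm (crandall_pazy f))\<^sup>2)"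
proof -
  let ?C = "closure (range F)"
  have near: "(norm (q - p))\<^sup>2 \<le> 2 * ((norm q)\<^sup>2 - (norm p)\<^sup>2)"
    if "p \<in> ?C" "\<And>q. q \<in> ?C \<Longrightarrow> norm p \<le> norm q" "q \<in> ?C" for p q
  proof -
    have "(norm p)\<^sup>2 \<le> (norm (midpoint q p))\<^sup>2"
      using that closure_range_gradient_midpoint[OF conv F] by (intro power_mono) auto
    then show ?thesis by (simp add: parallelogram_midpoint)
  qed
  obtain p where p: "p \<in> ?C" "\<And>q. q \<in> ?C \<Longrightarrow> norm p \<le> norm q"
    using ex_minimal_norm[of ?C] closure_range_gradient_midpoint[OF conv F] by auto
  have "(\<Union>x. subdifferential f x) = range F"
    using subdifferential_eq_gradient[OF conv F] by auto
  then have "crandall_pazy f = (THE p. p \<in> ?C \<and> (\<forall>q\<in>?C. norm p \<le> norm q))"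
    by (simp add: crandall_pazy_def metric_proj_def)
  also have "\<dots> = p"
  proof (rule the_equality)
    fix q assume q: "q \<in> ?C \<and> (\<forall>r\<in>?C. norm q \<le> norm r)"
    then have "norm q = norm p" using p by force
    with near[OF p, of q] q show "q = p" by simp
  qed (use p in blast)
  finally have eq: "crandall_pazy f = p" .
  show "crandall_pazy f \<in> ?C" using p(1) by (simp add: eq)
  show "(norm (q - crandall_pazy f))\<^sup>2 \<le> 2 * ((norm q)\<^sup>2 - (norm (crandall_pazy f))\<^sup>2)"
    if "q \<in> ?C" using near[OF p that] by (simp add: eq)
qed

section \<open>Explicit descent steps\<close>

lemma convex_gradient_monotone:
  fixes f :: "'a::real_inner \<Rightarrow> real"
  assumes "convex_on UNIV f" and "\<And>x. GDERIV f x :> F x"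
  shows "0 \<le> inner (F x - F y) (x - y)"
  using convex_gradient_inequality[OF assms(1) assms(2), of x y]
    convex_gradient_inequality[OF assms(1) assms(2), of y x]
  by (simp add: inner_diff_left inner_diff_right)

text \<open>
  To first order the norm of a monotone field does not increase along its own explicit Euler step:
  monotonicity says that the change of \<open>F\<close> has a nonpositive component along \<open>F x\<close>, and the
  Lipschitz bound makes the remaining contribution to \<open>\<parallel>F\<parallel>\<^sup>2\<close> quadratic in \<open>\<tau>\<close>.
\<close>
lemma monotone_euler_step:
  fixes F :: "'a::real_inner \<Rightarrow> 'a"
  assumes mono: "0 \<le> inner (F (x - \<tau> *\<^sub>R F x) - F x) ((x - \<tau> *\<^sub>R F x) - x)"
    and lip: "L-lipschitz_on U F" and U: "x \<in> U" "x - \<tau> *\<^sub>R F x \<in> U" and "0 < \<tau>"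
  shows "norm (F (x - \<tau> *\<^sub>R F x)) \<le> norm (F x) * (1 + (L * \<tau>)\<^sup>2)"
proof -
  let ?y = "x - \<tau> *\<^sub>R F x"
  have "0 \<le> \<tau> * inner (F x - F ?y) (F x)"
    using mono by (simp add: inner_diff_left right_diff_distrib)
  then have descent: "inner (F ?y) (F x) \<le> inner (F x) (F x)"
    using \<open>0 < \<tau>\<close> by (simp add: zero_le_mult_iff inner_diff_left)
  have "norm (F ?y - F x) \<le> L * dist ?y x"
    using lipschitz_onD[OF lip U(2,1)] by (simp add: dist_norm)
  also have "\<dots> = L * \<tau> * norm (F x)"
    using \<open>0 < \<tau>\<close> by (simp add: dist_norm)
  finally have "(norm (F ?y - F x))\<^sup>2 \<le> (L * \<tau> * norm (F x))\<^sup>2"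
    by (rule power_mono) simp
  moreover have "(norm (F ?y))\<^sup>2 = (norm (F x))\<^sup>2 + 2 * (inner (F ?y) (F x) - inner (F x) (F x))
      + (norm (F ?y - F x))\<^sup>2"
    unfolding power2_norm_eq_inner by (simp add: inner_diff_left inner_diff_right inner_commute)
  ultimately have "(norm (F ?y))\<^sup>2 \<le> (norm (F x))\<^sup>2 * (1 + (L * \<tau>)\<^sup>2)"
    using descent by (simp add: power_mult_distrib algebra_simps)
  also have "\<dots> \<le> (norm (F x))\<^sup>2 * (1 + (L * \<tau>)\<^sup>2)\<^sup>2"
    by (intro mult_left_mono self_le_power) auto
  finally show ?thesis
    by (simp add: power2_le_iff_abs_le flip: power_mult_distrib)
qed

text \<open>
  Up to an error quadratic in \<open>\<tau>\<close>, a step along \<open>-(F + G)\<close> is a step along \<open>-F\<close> followed by a step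
  along \<open>-G\<close>. The former increases \<open>\<parallel>F\<parallel>\<close> only to second order, the latter does so for \<open>\<parallel>G\<parallel>\<close>, and
  these norms agree everywhere.
\<close>
lemma norm_gradient_joint_step:
  fixes F G :: "'a::real_inner \<Rightarrow> 'a"
  assumes monoF: "\<And>x y. 0 \<le> inner (F x - F y) (x - y)"
    and monoG: "\<And>x y. 0 \<le> inner (G x - G y) (x - y)"
    and eq: "\<And>x. norm (F x) = norm (G x)"
    and lipF: "\<exists>r>0. \<exists>L. L-lipschitz_on (ball x r) F"
    and lipG: "\<exists>r>0. \<exists>L. L-lipschitz_on (ball x r) G"
    and "\<eta> > 0"
  shows "\<forall>\<^sub>F \<tau> in at_right 0. norm (F (x - \<tau> *\<^sub>R (F x + G x))) \<le> norm (F x) + \<eta> * \<tau>"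
proof -
  obtain r1 L1 r2 L2 where L12: "r1 > 0" "L1-lipschitz_on (ball x r1) F" "r2 > 0" "L2-lipschitz_on (ball x r2) G"
    using lipF lipG by blast
  define r L N where "r = min r1 r2" and "L = max L1 L2" and "N = norm (F x)"
  have r: "r > 0" and F: "L-lipschitz_on (ball x r) F" and G: "L-lipschitz_on (ball x r) G"
    using L12 by (auto simp: r_def L_def intro: lipschitz_on_mono)
  have L: "L \<ge> 0" using F by (rule lipschitz_on_nonneg)
  have N: "N \<ge> 0" "norm (G x) = N" "norm (F x) = N" by (auto simp: N_def eq)
  \<comment> \<open>The first bound absorbs higher powers of \<open>\<tau>\<close>, the second keeps all intermediate points in the
    ball, and the third makes the accumulated second-order error \<open>4 * L\<^sup>2 * N * \<tau>\<^sup>2\<close> acceptable.\<close>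
  have "\<forall>\<^sub>F \<tau> in at_right 0. L * \<tau> < 1"
    by (rule order_tendstoD) (auto intro!: tendsto_eq_intros)
  moreover have "\<forall>\<^sub>F \<tau> in at_right 0. 3 * N * \<tau> < r"
    using r by (intro order_tendstoD) (auto intro!: tendsto_eq_intros)
  moreover have "\<forall>\<^sub>F \<tau> in at_right 0. 4 * L\<^sup>2 * N * \<tau> < \<eta>"
    using \<open>\<eta> > 0\<close> by (intro order_tendstoD) (auto intro!: tendsto_eq_intros)
  ultimately show ?thesis
    using eventually_at_right_less[of "0::real"]
  proof eventually_elim
    case (elim \<tau>)
    define y where "y = x - \<tau> *\<^sub>R F x"
    define y2 where "y2 = y - \<tau> *\<^sub>R G y"
    define a where "a = (L * \<tau>)\<^sup>2"
    have a: "0 \<le> a" "a \<le> 1" using elim L by (auto simp: a_def power_le_one)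
    have N\<tau>: "0 \<le> N * \<tau>" using N elim by simp
    have "dist x y = N * \<tau>" using elim N by (simp add: y_def dist_norm mult.commute)
    with elim N\<tau> have y: "y \<in> ball x r" by simp
    have Ny: "norm (F y) \<le> N * (1 + a)"
      using monotone_euler_step[OF monoF F, of x \<tau>] elim r y by (simp add: N a_def y_def)
    have "N * a \<le> N" using a N by (simp add: mult_left_le)
    then have "norm (G y) \<le> 2 * N" using Ny by (simp add: eq algebra_simps)
    then have "norm (\<tau> *\<^sub>R G y) \<le> 2 * N * \<tau>"
      using elim by (simp add: mult.commute mult_left_mono)
    then have "dist x y2 \<le> N * \<tau> + 2 * N * \<tau>"
      using dist_triangle[of x y2 y] \<open>dist x y = N * \<tau>\<close> by (simp add: y2_def dist_norm)
    then have y2: "y2 \<in> ball x r" using elim by simp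
    have "norm (F y2) \<le> norm (F y) * (1 + a)"
      using monotone_euler_step[OF monoG G, of y \<tau>] elim y y2 by (simp add: eq a_def y2_def)
    also have "\<dots> \<le> N * (1 + a) * (1 + a)"
      using Ny a by (intro mult_right_mono) auto
    also have "\<dots> = N + (2 * (N * a) + (N * a) * a)" by (simp add: algebra_simps)
    also have "(N * a) * a \<le> N * a" using a N by (simp add: mult_left_le)
    finally have Ny2: "norm (F y2) \<le> N + 3 * (N * a)" by simp
    let ?y3 = "x - \<tau> *\<^sub>R (F x + G x)"
    have "norm (\<tau> *\<^sub>R (F x + G x)) \<le> \<tau> * (N + N)"
      using elim norm_triangle_ineq[of "F x" "G x"] N by simp
    then have y3: "?y3 \<in> ball x r" using elim N\<tau> by (simp add: dist_norm algebra_simps)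
    have "norm (F ?y3 - F y2) \<le> L * dist ?y3 y2"
      using lipschitz_onD[OF F y3 y2] by (simp add: dist_norm)
    also have "dist ?y3 y2 = norm (?y3 - y2)" by (rule dist_norm)
    also have "?y3 - y2 = \<tau> *\<^sub>R (G y - G x)" by (simp add: y2_def y_def algebra_simps)
    also have "norm (\<tau> *\<^sub>R (G y - G x)) = \<tau> * dist (G y) (G x)" using elim by (simp add: dist_norm)
    also have "L * (\<tau> * dist (G y) (G x)) \<le> L * (\<tau> * (L * dist y x))"
      using lipschitz_onD[OF G y, of x] r L elim by (intro mult_left_mono) auto
    also have "\<dots> = N * a"
      using \<open>dist x y = N * \<tau>\<close> by (simp add: dist_commute a_def power2_eq_square)
    finally have "norm (F ?y3) \<le> N + 4 * (N * a)"
      using Ny2 norm_triangle_ineq[of "F ?y3 - F y2" "F y2"] by simp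
    also have "4 * (N * a) = (4 * L\<^sup>2 * N * \<tau>) * \<tau>" by (simp add: a_def power2_eq_square)
    also have "\<dots> \<le> \<eta> * \<tau>" using elim by (intro mult_right_mono) auto
    finally show ?case by (simp add: N)
  qed
qed

lemma norm_square_step:
  fixes a b :: "'a::real_inner"
  assumes "\<eta> > 0"
  shows "\<forall>\<^sub>F \<tau> in at_right 0. (norm (a - \<tau> *\<^sub>R b))\<^sup>2 \<le> (norm a)\<^sup>2 - 2 * \<tau> * inner a b + \<eta> * \<tau>"
proof -
  have "\<forall>\<^sub>F \<tau> in at_right 0. (norm b)\<^sup>2 * \<tau> < \<eta>"
    using \<open>\<eta> > 0\<close> by (intro order_tendstoD) (auto intro!: tendsto_eq_intros)
  with eventually_at_right_less[of "0::real"] show ?thesis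
  proof eventually_elim
    case (elim \<tau>)
    have "(norm (a - \<tau> *\<^sub>R b))\<^sup>2 = (norm a)\<^sup>2 - 2 * \<tau> * inner a b + ((norm b)\<^sup>2 * \<tau>) * \<tau>"
      unfolding power2_norm_eq_inner by (simp add: inner_simps inner_commute algebra_simps)
    also have "((norm b)\<^sup>2 * \<tau>) * \<tau> \<le> \<eta> * \<tau>" using elim by (intro mult_right_mono) auto
    finally show ?case by simp
  qed
qed

section \<open>Simultaneous descent of three points\<close>

text \<open>
  The approximate descent of three points along \<open>-\<nabla>(f + g)\<close>, stopped when the two monotonicity gaps
  with respect to \<open>w\<close> are small. As long as their sum exceeds \<open>\<delta>\<close>, the sum \<open>Q\<close> of the squared
  distances to \<open>w\<close> decreases at least at rate \<open>\<delta>\<close>, so the descent must stop by the time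
  \<open>T = Q x0 z0 w0 / \<delta>\<close>; the error rate \<open>\<eta>\<close> is chosen so small that the errors accumulated by then
  stay below \<open>\<kappa>\<close>. The norms of all three gradients are monitored, not just that of \<open>w\<close>, because
  they bound the speed.
\<close>
lemma joint_descent:
  fixes f g :: "'a::{real_inner, complete_space} \<Rightarrow> real" and F G :: "'a \<Rightarrow> 'a"
  assumes convf: "convex_on UNIV f" and convg: "convex_on UNIV g"
    and F: "\<And>x. GDERIV f x :> F x" and G: "\<And>x. GDERIV g x :> G x"
    and eq: "\<And>x. norm (F x) = norm (G x)"
    and lipF: "\<And>x. \<exists>r>0. \<exists>L. L-lipschitz_on (ball x r) F"
    and lipG: "\<And>x. \<exists>r>0. \<exists>L. L-lipschitz_on (ball x r) G"
    and pos: "\<delta> > 0" "\<kappa> > 0"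
  obtains x z w where "norm (F w) \<le> norm (F w0) + \<kappa>"
    and "(norm (x - z))\<^sup>2 \<le> (norm (x0 - z0))\<^sup>2 + \<kappa>"
    and "\<bar>(f x - g x) - (f x0 - g x0)\<bar> \<le> \<kappa>" and "\<bar>(f z - g z) - (f z0 - g z0)\<bar> \<le> \<kappa>"
    and "inner (F x + G x - (F w + G w)) (x - w) + inner (F z + G z - (F w + G w)) (z - w) \<le> \<delta>"
proof (rule ccontr)
  define S where "S x = F x + G x" for x
  define h where "h x = f x - g x" for x
  define gap where "gap x w = inner (S x - S w) (x - w)" for x w
  define Q where "Q x z w = (norm (x - w))\<^sup>2 + (norm (z - w))\<^sup>2" for x z w :: 'a
  define T where "T = Q x0 z0 w0 / \<delta>"
  define \<eta> where "\<eta> = \<kappa> / (T + 1)"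
  assume "\<not> thesis"
  with that have no: "\<delta> < gap x w + gap z w"
    if "norm (F w) \<le> norm (F w0) + \<kappa>" "(norm (x - z))\<^sup>2 \<le> (norm (x0 - z0))\<^sup>2 + \<kappa>"
      "\<bar>h x - h x0\<bar> \<le> \<kappa>" "\<bar>h z - h z0\<bar> \<le> \<kappa>" for x z w
    using that by (force simp: gap_def S_def h_def not_le)
  note monoF = convex_gradient_monotone[OF convf F] and monoG = convex_gradient_monotone[OF convg G]
  have gap0: "0 \<le> gap x z" for x z
    using monoF[of x z] monoG[of x z] by (simp add: gap_def S_def inner_simps)
  have T: "T \<ge> 0" using pos by (simp add: T_def Q_def)
  have \<eta>: "\<eta> > 0" using pos T by (simp add: \<eta>_def)
  have \<eta>T: "\<eta> * t \<le> \<kappa>" if "t \<le> T" for t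
  proof -
    have "\<eta> * t \<le> \<eta> * (T + 1)" using that \<eta> by (intro mult_left_mono) auto
    then show ?thesis using T by (simp add: \<eta>_def)
  qed
  \<comment> \<open>The admissible states: time together with the three points.\<close>
  define A where "A = {X. 0 \<le> fst X \<and>
      norm (F (fst (snd X))) \<le> norm (F x0) + \<eta> * fst X \<and>
      norm (F (fst (snd (snd X)))) \<le> norm (F z0) + \<eta> * fst X \<and>
      norm (F (snd (snd (snd X)))) \<le> norm (F w0) + \<eta> * fst X \<and>
      (norm (fst (snd X) - fst (snd (snd X))))\<^sup>2 \<le> (norm (x0 - z0))\<^sup>2 + \<eta> * fst X \<and>
      \<bar>h (fst (snd X)) - h x0\<bar> \<le> \<eta> * fst X \<and>
      \<bar>h (fst (snd (snd X))) - h z0\<bar> \<le> \<eta> * fst X \<and>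
      Q (fst (snd X)) (fst (snd (snd X))) (snd (snd (snd X))) \<le> Q x0 z0 w0 - \<delta> * fst X}"
  have A_iff: "(t, x, z, w) \<in> A \<longleftrightarrow> 0 \<le> t \<and> norm (F x) \<le> norm (F x0) + \<eta> * t \<and>
      norm (F z) \<le> norm (F z0) + \<eta> * t \<and> norm (F w) \<le> norm (F w0) + \<eta> * t \<and>
      (norm (x - z))\<^sup>2 \<le> (norm (x0 - z0))\<^sup>2 + \<eta> * t \<and>
      \<bar>h x - h x0\<bar> \<le> \<eta> * t \<and> \<bar>h z - h z0\<bar> \<le> \<eta> * t \<and>
      Q x z w \<le> Q x0 z0 w0 - \<delta> * t" for t x z w
    by (simp add: A_def)
  have contF: "continuous_on UNIV F"
  proof (intro continuous_at_imp_continuous_on ballI)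
    fix x
    obtain r L where "r > 0" "L-lipschitz_on (ball x r) F" using lipF by blast
    then show "isCont F x"
      by (meson centre_in_ball continuous_on_eq_continuous_at lipschitz_on_continuous_on open_ball)
  qed
  have conth: "continuous_on UNIV h"
    unfolding h_def using F G unfolding gderiv_def
    by (intro continuous_intros) (meson has_derivative_continuous continuous_at_imp_continuous_on)+
  have in_time: "t \<le> T" if "(t, x, z, w) \<in> A" for t x z w
  proof -
    have "0 \<le> Q x z w" by (simp add: Q_def)
    with that pos show ?thesis by (simp add: A_iff T_def field_simps)
  qed
  have h_step: "\<forall>\<^sub>F \<tau> in at_right 0. \<bar>h (x - \<tau> *\<^sub>R S x) - h x\<bar> \<le> \<eta> * \<tau>" for x
  proof -
    have "GDERIV h x :> F x - G x"
      unfolding h_def using F[of x] G[of x] by (rule GDERIV_diff)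
    from GDERIV_step[OF this \<eta>, of "- S x"]
    have "\<forall>\<^sub>F \<tau> in at_right 0. \<bar>h (x + \<tau> *\<^sub>R - S x) - h x - \<tau> * inner (- S x) (F x - G x)\<bar> \<le> \<eta> * \<tau>" .
    \<comment> \<open>This is \<open>\<langle>\<nabla>s, \<nabla>h\<rangle> = \<parallel>F x\<parallel>\<^sup>2 - \<parallel>G x\<parallel>\<^sup>2 = 0\<close>, up to sign.\<close>
    moreover have "inner (- S x) (F x - G x) = 0"
      using eq[of x] by (simp add: S_def inner_simps inner_commute norm_eq_sqrt_inner)
    ultimately show ?thesis by simp
  qed
  define M where "M = 2 * (norm (F x0) + norm (F z0) + norm (F w0) + 3 * \<kappa>)"
  show False
  proof (rule drop_principle)
    show "closed A" unfolding A_def Q_def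
      by (intro closed_Collect_conj closed_Collect_le continuous_intros
          continuous_on_compose2[OF contF] continuous_on_compose2[OF conth]) auto
    show "(0, x0, z0, w0) \<in> A" by (simp add: A_iff)
    show "t \<le> T" if "(t, X) \<in> A" for t X
      using that in_time by (cases X) auto
    show "\<exists>t' X'. (t', X') \<in> A \<and> t < t' \<and> dist X X' \<le> M * (t' - t)" if tX: "(t, X) \<in> A" for t X
    proof -
      obtain x z w where X: "X = (x, z, w)" by (cases X)
      note inA = tX[unfolded X A_iff]
      have t: "\<eta> * t \<le> \<kappa>" using in_time tX X \<eta>T by blast
      have big: "\<delta> < gap x w + gap z w"
        using inA t by (intro no) linarith+
      note N_step = norm_gradient_joint_step[OF monoF monoG eq lipF lipG \<eta>, folded S_def]
      \<comment> \<open>The exact rate of \<open>Q\<close> is below \<open>-2 * \<delta>\<close>; half of this margin, shared by its two squares,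
        pays for the second-order terms.\<close>
      have "\<forall>\<^sub>F \<tau> in at_right 0. 0 < \<tau> \<and>
        (t + \<tau>, x - \<tau> *\<^sub>R S x, z - \<tau> *\<^sub>R S z, w - \<tau> *\<^sub>R S w) \<in> A"
        using eventually_at_right_less[of "0::real"] N_step[of x] N_step[of z] N_step[of w] h_step[of x] h_step[of z]
          norm_square_step[OF \<eta>, of "x - z" "S x - S z"]
          norm_square_step[OF half_gt_zero[OF pos(1)], of "x - w" "S x - S w"]
          norm_square_step[OF half_gt_zero[OF pos(1)], of "z - w" "S z - S w"]
      proof eventually_elim
        case (elim \<tau>)
        have diff: "a - \<tau> *\<^sub>R S a - (b - \<tau> *\<^sub>R S b) = (a - b) - \<tau> *\<^sub>R (S a - S b)" for a b
          by (simp add: algebra_simps)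
        have gaps: "inner (a - b) (S a - S b) = gap a b" for a b
          by (simp add: gap_def inner_commute)
        have "0 \<le> \<tau> * gap x z" using gap0 elim by simp
        moreover have "\<tau> * \<delta> \<le> \<tau> * (gap x w + gap z w)"
          using big elim by (intro mult_left_mono) auto
        ultimately show ?case
          using elim inA unfolding A_iff Q_def diff gaps by (auto simp: algebra_simps)
      qed
      then obtain \<tau> where \<tau>: "0 < \<tau>" "(t + \<tau>, x - \<tau> *\<^sub>R S x, z - \<tau> *\<^sub>R S z, w - \<tau> *\<^sub>R S w) \<in> A"
        using eventually_happens' trivial_limit_at_right_real by blast
      have S_le: "norm (S y) \<le> 2 * norm (F y)" for y
        using norm_triangle_ineq[of "F y" "G y"] by (simp add: S_def eq)
      have "dist X (x - \<tau> *\<^sub>R S x, z - \<tau> *\<^sub>R S z, w - \<tau> *\<^sub>R S w) = norm (\<tau> *\<^sub>R (S x, S z, S w))"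
        by (simp add: X dist_norm)
      also have "\<dots> \<le> \<tau> * (norm (S x) + (norm (S z) + norm (S w)))"
        using \<tau>(1) norm_Pair_le[of "S x" "(S z, S w)"] norm_Pair_le[of "S z" "S w"]
        by (simp del: scaleR_Pair)
      also have "\<dots> \<le> \<tau> * M"
        using \<tau>(1) inA t S_le[of x] S_le[of z] S_le[of w]
        by (intro mult_left_mono) (auto simp: M_def)
      finally show ?thesis using \<tau>
        by (intro exI[of _ "t + \<tau>"] exI[of _ "(x - \<tau> *\<^sub>R S x, z - \<tau> *\<^sub>R S z, w - \<tau> *\<^sub>R S w)"])
          (simp add: mult.commute)
    qed
  qed
qed

section \<open>Constancy of the difference\<close>

text \<open>
  The linearization errors of \<open>f\<close> and \<open>g\<close> at \<open>w\<close> are nonnegative and bounded by the monotonicity gaps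
  of \<open>f\<close> and \<open>g\<close>, so their difference is bounded by the sum of the gaps.
\<close>
lemma linearization_error_le_gap:
  fixes f g :: "'a::real_inner \<Rightarrow> real"
  assumes convf: "convex_on UNIV f" and convg: "convex_on UNIV g"
    and F: "\<And>x. GDERIV f x :> F x" and G: "\<And>x. GDERIV g x :> G x"
  shows "\<bar>(f x - g x) - (f w - g w) - inner (F w - G w) (x - w)\<bar>
    \<le> inner (F x + G x - (F w + G w)) (x - w)"
  using convex_gradient_inequality[OF convf F, of w x] convex_gradient_inequality[OF convf F, of x w]
    convex_gradient_inequality[OF convg G, of w x] convex_gradient_inequality[OF convg G, of x w]
  by (simp add: inner_simps)

theorem theorem3p1:
  fixes f g :: "'a::{real_inner, complete_space} \<Rightarrow> real"
  assumes "convex_on UNIV f" and "convex_on UNIV g"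
    and "C11_loc f" and "C11_loc g"
    and "\<And>x. norm (gradient f x) = norm (gradient g x)"
    and "crandall_pazy f = crandall_pazy g"
  shows "\<exists>c. \<forall>x. f x = g x + c"
proof -
  let ?F = "gradient f" and ?G = "gradient g"
  define p where "p = crandall_pazy f"
  have F: "GDERIV f x :> ?F x" and G: "GDERIV g x :> ?G x" for x
    using assms(3,4) by (auto simp: C11_loc_def intro: GDERIV_gradient)
  have lipF: "\<exists>r>0. \<exists>L. L-lipschitz_on (ball x r) ?F" and lipG: "\<exists>r>0. \<exists>L. L-lipschitz_on (ball x r) ?G" for x
    using assms(3,4) by (auto simp: C11_loc_def)
  note pf = crandall_pazy_near_short_gradients[OF assms(1) F, folded p_def]
  note pg = crandall_pazy_near_short_gradients[OF assms(2) G, folded assms(6), folded p_def]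
  \<comment> \<open>Of \<open>2 * \<epsilon>\<close>, the gaps contribute \<open>\<epsilon>\<close> and the changes of \<open>f - g\<close> at the two ends \<open>\<epsilon> / 2\<close> each.\<close>
  have bound: "\<bar>(f x0 - g x0) - (f z0 - g z0)\<bar>
      \<le> 2 * \<epsilon> + 2 * sqrt (2 * ((norm p + \<epsilon>)\<^sup>2 - (norm p)\<^sup>2)) * sqrt ((norm (x0 - z0))\<^sup>2 + \<epsilon>)"
    if "\<epsilon> > 0" for \<epsilon> x0 z0
  proof -
    obtain w0 where "dist (?F w0) p < \<epsilon> / 2"
      using pf(1) \<open>\<epsilon> > 0\<close> unfolding closure_approachable by (metis half_gt_zero rangeE)
    then have w0: "norm (?F w0) \<le> norm p + \<epsilon> / 2"
      using norm_triangle_ineq[of "?F w0 - p" p] by (simp add: dist_norm)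
    obtain x z w where w: "norm (?F w) \<le> norm (?F w0) + \<epsilon> / 2"
      and xz: "(norm (x - z))\<^sup>2 \<le> (norm (x0 - z0))\<^sup>2 + \<epsilon> / 2"
      and h: "\<bar>(f x - g x) - (f x0 - g x0)\<bar> \<le> \<epsilon> / 2" "\<bar>(f z - g z) - (f z0 - g z0)\<bar> \<le> \<epsilon> / 2"
      and gap: "inner (?F x + ?G x - (?F w + ?G w)) (x - w)
        + inner (?F z + ?G z - (?F w + ?G w)) (z - w) \<le> \<epsilon>"
      using joint_descent[OF assms(1,2) F G assms(5) lipF lipG \<open>\<epsilon> > 0\<close> half_gt_zero[OF \<open>\<epsilon> > 0\<close>],
          of w0 x0 z0] by metis
    \<comment> \<open>Bounds the distance to \<open>p\<close> of every gradient of length at most \<open>\<parallel>p\<parallel> + \<epsilon>\<close>.\<close>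
    define c where "c = sqrt (2 * ((norm p + \<epsilon>)\<^sup>2 - (norm p)\<^sup>2))"
    have near: "norm (H w - p) \<le> c"
      if "norm (H w) = norm (?F w)" "(norm (H w - p))\<^sup>2 \<le> 2 * ((norm (H w))\<^sup>2 - (norm p)\<^sup>2)" for H
    proof -
      have "(norm (H w))\<^sup>2 \<le> (norm p + \<epsilon>)\<^sup>2"
        using w w0 that by (intro power_mono) auto
      with that(2) show ?thesis unfolding c_def by (intro real_le_rsqrt) (simp add: algebra_simps)
    qed
    have "norm (?F w - p) \<le> c"
      using pf(2)[OF closure_subset[THEN subsetD, OF rangeI]] by (intro near) auto
    moreover have "norm (?G w - p) \<le> c"
      using pg(2)[OF closure_subset[THEN subsetD, OF rangeI]] assms(5) by (intro near) auto
    ultimately have FG: "norm (?F w - ?G w) \<le> 2 * c"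
      using norm_triangle_ineq4[of "?F w - p" "?G w - p"] by simp
    have "norm (x - z) \<le> sqrt ((norm (x0 - z0))\<^sup>2 + \<epsilon>)"
      using xz \<open>\<epsilon> > 0\<close> by (intro real_le_rsqrt) linarith
    then have "\<bar>inner (?F w - ?G w) (x - z)\<bar> \<le> 2 * c * sqrt ((norm (x0 - z0))\<^sup>2 + \<epsilon>)"
      using FG order_trans[OF norm_ge_zero FG] by (intro order_trans[OF Cauchy_Schwarz_ineq2] mult_mono) auto
    moreover have "inner (?F w - ?G w) (x - z) = inner (?F w - ?G w) (x - w) - inner (?F w - ?G w) (z - w)"
      by (simp add: inner_diff_right)
    ultimately show ?thesis
      using h gap linearization_error_le_gap[OF assms(1,2) F G, of x w]
        linearization_error_le_gap[OF assms(1,2) F G, of z w]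
      unfolding c_def by linarith
  qed
  have "f x - g x = f z - g z" for x z
  proof -
    let ?b = "\<lambda>\<epsilon>. 2 * \<epsilon> + 2 * sqrt (2 * ((norm p + \<epsilon>)\<^sup>2 - (norm p)\<^sup>2)) * sqrt ((norm (x - z))\<^sup>2 + \<epsilon>)"
    have "(?b \<longlongrightarrow> 0) (at_right 0)"
      by (auto intro!: tendsto_eq_intros)
    moreover have "\<forall>\<^sub>F \<epsilon> in at_right 0. \<bar>(f x - g x) - (f z - g z)\<bar> \<le> ?b \<epsilon>"
      using eventually_at_right_less[of "0::real"] by eventually_elim (rule bound)
    ultimately have "\<bar>(f x - g x) - (f z - g z)\<bar> \<le> 0"
      by (intro tendsto_lowerbound) auto
    then show ?thesis by simp
  qed
  then have "f x = g x + (f 0 - g 0)" for x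
    by (metis add.commute diff_add_cancel)
  then show ?thesis by blast
qed

end
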